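(* Let $n\ge 1$. A skew polynomial $f\in \mathrm{OPol}_n$ is fixed under the action of $\mathcal{H}_{-1}(n)$ on $\mathrm{OPol}_n$, i.e. $T_i(f)=f$ for all $1\le i\le n-1$, if and only if $f$ is an odd symmetric function, i.e. $f\in \mathrm{O}\Lambda_n$.
   Context: $\mathrm{OPol}_n=\mathbb{Z}\langle x_1,\dots,x_n\rangle/\langle x_ix_j+x_jx_i=0 \text{ for } i\ne j\rangle$ is the ring of skew polynomials. For $1\le i\le n-1$ let $s_i$ be the ring endomorphism of $\mathrm{OPol}_n$ with $s_i(x_i)=-x_{i+1}$, $s_i(x_{i+1})=-x_i$, $s_i(x_j)=-x_j$ for $j\ne i,i+1$. The odd divided difference operator $\partial_i$ is the additive operator on $\mathrm{OPol}_n$ determined by $\partial_i(1)=0$, $\partial_i(x_j)=1$ if $j\in\{i,i+1\}$ and $0$ otherwise, and the Leibniz rule $\partial_i(fg)=\partial_i(f)g+s_i(f)\partial_i(g)$. The ring of odd symmetric functions (polynomials) is $\mathrm{O}\Lambda_n=\bigcap_{i=1}^{n-1}\ker(\partial_i)\subset \mathrm{OPol}_n$. $\mathcal{H}_{-1}(n)$ is the Hecke algebra at $q=-1$: the unital associative $\mathbb{Z}$-algebra with generators $T_1,\dots,T_{n-1}$ and relations $T_i^2=2T_i-1$, $T_iT_j=T_jT_i$ for $|i-j|>1$, $T_iT_{i+1}T_i=T_{i+1}T_iT_{i+1}$. It acts on $\mathrm{OPol}_n$ with $T_i$ acting as the operator $\partial_ix_i+x_i\partial_i=1+(x_i-x_{i+1})\partial_i$,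 where $x_j$ denotes left multiplication by $x_j$. *)

theory Defs
  imports "HOL-Algebra.QuotRing" "HOL-Library.FuncSet" "HOL-Library.Poly_Mapping"
begin

section \<open>Unital rings presented by generators and relations\<close>

text \<open>Words in letters indexed by natural numbers form a monoid under concatenation. It is written
  additively, because the convolution product on finitely supported functions is set up in the
  library for additive index monoids; the type \<open>word \<Rightarrow>\<^sub>0 int\<close> is then the free ring on all letters.\<close>

datatype word = Word (letters: "nat list")

instantiation word :: monoid_add
begin

definition zero_word :: word where "0 = Word []"

definition plus_word :: "word \<Rightarrow> word \<Rightarrow> word" where "u + v = Word (letters u @ letters v)"

instance
  by standard (simp_all add: zero_word_def plus_word_def)

end

lemma letters_zero [simp]: "letters 0 = []"
  by (simp add: zero_word_def)

lemma letters_plus [simp]: "letters (u + v) = letters u @ letters v"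
  by (simp add: plus_word_def)

definition letter :: "nat \<Rightarrow> word \<Rightarrow>\<^sub>0 int" where
  "letter i = Poly_Mapping.single (Word [i]) 1"

definition free_ring :: "nat set \<Rightarrow> (word \<Rightarrow>\<^sub>0 int) ring" where
  "free_ring S =
    \<lparr>carrier = {p. \<forall>w\<in>Poly_Mapping.keys p. set (letters w) \<subseteq> S},
     monoid.mult = (*), one = 1, zero = 0, add = (+)\<rparr>"

text \<open>The quotient by the two-sided ideal generated by the relators \<open>E\<close>.\<close>

definition presented_ring :: "nat set \<Rightarrow> (word \<Rightarrow>\<^sub>0 int) set \<Rightarrow> (word \<Rightarrow>\<^sub>0 int) set ring" where
  "presented_ring S E = free_ring S Quot (Idl\<^bsub>free_ring S\<^esub> E)"

definition generator :: "nat set \<Rightarrow> (word \<Rightarrow>\<^sub>0 int) set \<Rightarrow> nat \<Rightarrow> (word \<Rightarrow>\<^sub>0 int) set" where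
  "generator S E i = (Idl\<^bsub>free_ring S\<^esub> E) +>\<^bsub>free_ring S\<^esub> letter i"

lemma free_ring_simps:
  "p \<oplus>\<^bsub>free_ring S\<^esub> q = p + q" "p \<otimes>\<^bsub>free_ring S\<^esub> q = p * q"
  "\<zero>\<^bsub>free_ring S\<^esub> = 0" "\<one>\<^bsub>free_ring S\<^esub> = 1"
  by (simp_all add: free_ring_def)

lemma in_free_ring_iff:
  "p \<in> carrier (free_ring S) \<longleftrightarrow> (\<forall>w\<in>Poly_Mapping.keys p. set (letters w) \<subseteq> S)"
  by (simp add: free_ring_def)

lemma free_ring_plus:
  assumes "p \<in> carrier (free_ring S)" "q \<in> carrier (free_ring S)"
  shows "p + q \<in> carrier (free_ring S)"
  using assms Poly_Mapping.keys_add[of p q] unfolding in_free_ring_iff by blast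

lemma free_ring_times:
  assumes "p \<in> carrier (free_ring S)" "q \<in> carrier (free_ring S)"
  shows "p * q \<in> carrier (free_ring S)"
  unfolding in_free_ring_iff
proof
  fix w assume "w \<in> Poly_Mapping.keys (p * q)"
  then obtain u v where "u \<in> Poly_Mapping.keys p" "v \<in> Poly_Mapping.keys q" "w = u + v"
    using Poly_Mapping.keys_mult[of p q] by blast
  then show "set (letters w) \<subseteq> S"
    using assms by (simp add: in_free_ring_iff)
qed

lemma ring_free_ring: "ring (free_ring S)"
proof (rule ringI)
  show "abelian_group (free_ring S)"
  proof (rule abelian_groupI)
    fix p assume "p \<in> carrier (free_ring S)"
    then have "- p \<in> carrier (free_ring S)"
      by (simp add: in_free_ring_iff)
    then show "\<exists>q\<in>carrier (free_ring S). q \<oplus>\<^bsub>free_ring S\<^esub> p = \<zero>\<^bsub>free_ring S\<^esub>"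
      by (intro bexI[of _ "- p"]) (simp_all add: free_ring_simps)
  next
    show "\<zero>\<^bsub>free_ring S\<^esub> \<in> carrier (free_ring S)"
      by (simp add: in_free_ring_iff free_ring_simps)
  qed (simp_all add: free_ring_simps free_ring_plus add.assoc)
  show "Group.monoid (free_ring S)"
  proof (rule monoidI)
    show "\<one>\<^bsub>free_ring S\<^esub> \<in> carrier (free_ring S)"
      by (simp add: in_free_ring_iff free_ring_simps)
  qed (simp_all add: free_ring_simps free_ring_times mult.assoc)
qed (simp_all add: free_ring_simps distrib_left distrib_right)

lemma ring_presented_ring:
  assumes "E \<subseteq> carrier (free_ring S)"
  shows "ring (presented_ring S E)"
  unfolding presented_ring_def
  by (intro ideal.quotient_is_ring ring.genideal_ideal ring_free_ring assms)


section \<open>Skew polynomials and odd divided differences\<close>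

definition opol_relators :: "nat \<Rightarrow> (word \<Rightarrow>\<^sub>0 int) set" where
  "opol_relators n =
    {letter i * letter j + letter j * letter i |i j. i \<in> {1..n} \<and> j \<in> {1..n} \<and> i \<noteq> j}"

definition OPol :: "nat \<Rightarrow> (word \<Rightarrow>\<^sub>0 int) set ring" where
  "OPol n = presented_ring {1..n} (opol_relators n)"

definition opol_x :: "nat \<Rightarrow> nat \<Rightarrow> (word \<Rightarrow>\<^sub>0 int) set" where
  "opol_x n j = generator {1..n} (opol_relators n) j"

text \<open>Operators on a carrier set are taken to be \<^const>\<open>extensional\<close>, so that the
  conditions below determine them as functions on the whole type.\<close>

definition opol_s :: "nat \<Rightarrow> nat \<Rightarrow> (word \<Rightarrow>\<^sub>0 int) set \<Rightarrow> (word \<Rightarrow>\<^sub>0 int) set" where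
  "opol_s n i = (THE s. s \<in> extensional (carrier (OPol n)) \<and> s \<in> ring_hom (OPol n) (OPol n) \<and>
     s (opol_x n i) = \<ominus>\<^bsub>OPol n\<^esub> opol_x n (i + 1) \<and>
     s (opol_x n (i + 1)) = \<ominus>\<^bsub>OPol n\<^esub> opol_x n i \<and>
     (\<forall>j\<in>{1..n} - {i, i + 1}. s (opol_x n j) = \<ominus>\<^bsub>OPol n\<^esub> opol_x n j))"

definition odd_dd :: "nat \<Rightarrow> nat \<Rightarrow> (word \<Rightarrow>\<^sub>0 int) set \<Rightarrow> (word \<Rightarrow>\<^sub>0 int) set" where
  "odd_dd n i = (THE D. D \<in> extensional (carrier (OPol n)) \<and>
     D \<in> hom (add_monoid (OPol n)) (add_monoid (OPol n)) \<and>
     D \<one>\<^bsub>OPol n\<^esub> = \<zero>\<^bsub>OPol n\<^esub> \<and>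
     (\<forall>j\<in>{1..n}. D (opol_x n j) = (if j \<in> {i, i + 1} then \<one>\<^bsub>OPol n\<^esub> else \<zero>\<^bsub>OPol n\<^esub>)) \<and>
     (\<forall>f\<in>carrier (OPol n). \<forall>g\<in>carrier (OPol n).
        D (f \<otimes>\<^bsub>OPol n\<^esub> g) =
          D f \<otimes>\<^bsub>OPol n\<^esub> g \<oplus>\<^bsub>OPol n\<^esub> opol_s n i f \<otimes>\<^bsub>OPol n\<^esub> D g))"

definition OLambda :: "nat \<Rightarrow> (word \<Rightarrow>\<^sub>0 int) set set" where
  "OLambda n =
    {f \<in> carrier (OPol n). \<forall>i\<in>{1..<n}. f \<in> a_kernel (OPol n) (OPol n) (odd_dd n i)}"


section \<open>The Hecke algebra at \<open>q = -1\<close> and its action\<close>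

definition hecke_relators :: "nat \<Rightarrow> (word \<Rightarrow>\<^sub>0 int) set" where
  "hecke_relators n =
    {letter i * letter i - (2 * letter i - 1) |i. i \<in> {1..<n}} \<union>
    {letter i * letter j - letter j * letter i |i j.
       i \<in> {1..<n} \<and> j \<in> {1..<n} \<and> \<bar>int i - int j\<bar> > 1} \<union>
    {letter i * letter (i + 1) * letter i - letter (i + 1) * letter i * letter (i + 1) |i.
       i \<in> {1..<n} \<and> i + 1 \<in> {1..<n}}"

definition Hecke :: "nat \<Rightarrow> (word \<Rightarrow>\<^sub>0 int) set ring" where
  "Hecke n = presented_ring {1..<n} (hecke_relators n)"

definition hecke_T :: "nat \<Rightarrow> nat \<Rightarrow> (word \<Rightarrow>\<^sub>0 int) set" where
  "hecke_T n i = generator {1..<n} (hecke_relators n) i"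

text \<open>The ring of additive endomorphisms of (the additive group of) a ring, with composition as
  multiplication.\<close>

definition add_End :: "('a, 'b) ring_scheme \<Rightarrow> ('a \<Rightarrow> 'a) ring" where
  "add_End R =
    \<lparr>carrier = extensional (carrier R) \<inter> hom (add_monoid R) (add_monoid R),
     monoid.mult = compose (carrier R),
     one = (\<lambda>f\<in>carrier R. f),
     zero = (\<lambda>f\<in>carrier R. \<zero>\<^bsub>R\<^esub>),
     add = (\<lambda>\<phi> \<psi>. \<lambda>f\<in>carrier R. \<phi> f \<oplus>\<^bsub>R\<^esub> \<psi> f)\<rparr>"

definition hecke_operator :: "nat \<Rightarrow> nat \<Rightarrow> (word \<Rightarrow>\<^sub>0 int) set \<Rightarrow> (word \<Rightarrow>\<^sub>0 int) set" where
  "hecke_operator n i = (\<lambda>f\<in>carrier (OPol n).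
     odd_dd n i (opol_x n i \<otimes>\<^bsub>OPol n\<^esub> f) \<oplus>\<^bsub>OPol n\<^esub> opol_x n i \<otimes>\<^bsub>OPol n\<^esub> odd_dd n i f)"

definition hecke_action ::
    "nat \<Rightarrow> (word \<Rightarrow>\<^sub>0 int) set \<Rightarrow> (word \<Rightarrow>\<^sub>0 int) set \<Rightarrow> (word \<Rightarrow>\<^sub>0 int) set" where
  "hecke_action n = (THE \<rho>. \<rho> \<in> extensional (carrier (Hecke n)) \<and>
     \<rho> \<in> ring_hom (Hecke n) (add_End (OPol n)) \<and>
     (\<forall>i\<in>{1..<n}. \<rho> (hecke_T n i) = hecke_operator n i))"

end

theory Submission
  imports Defs
begin

text \<open>The operator \<open>T\<^sub>i\<close> is \<open>1 + (x\<^sub>i - x\<^sub>i\<^sub>+\<^sub>1) \<partial>\<^sub>i\<close>. Hence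
  \<open>T\<^sub>i f = f\<close> says \<open>(x\<^sub>i - x\<^sub>i\<^sub>+\<^sub>1) \<partial>\<^sub>i f = 0\<close>, and the theorem holds because
  \<open>x\<^sub>i - x\<^sub>i\<^sub>+\<^sub>1\<close> can be cancelled on the left in the ring of skew polynomials
  (\<open>letter_diff_cancel\<close>). The cancellation uses an auxiliary twisted derivation \<open>\<theta>\<close> with
  \<open>\<theta> x\<^sub>i = 1\<close> and \<open>\<theta> x\<^sub>j = - x\<^sub>j \<theta>\<close> for \<open>j \<noteq> i\<close>: if
  \<open>(x\<^sub>i - x\<^sub>i\<^sub>+\<^sub>1) g = 0\<close>, then \<open>g = - x\<^sub>i\<^sub>+\<^sub>1 \<theta> g\<close>, and iterating kills \<open>g\<close>
  because \<open>\<theta>\<close> is locally nilpotent.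

  Most of the work goes into showing that \<open>s\<^sub>i\<close>, \<open>\<partial>\<^sub>i\<close> and the Hecke action, which are
  given by characterizing properties, exist and are unique (\<open>opol_s_eq\<close>, \<open>odd_dd_eq\<close>,
  \<open>hecke_action_eq\<close>). Uniqueness is an induction on words in the generators
  (\<open>additive_eqI\<close>). For existence, each operator is first defined on the free ring by its
  effect on left multiplication by a letter, and then shown to preserve the ideal of relations.

  For the Hecke action the relations of the Hecke algebra have to be verified. The nilpotence,
  anticommutation and braid relations of the \<open>\<partial>\<^sub>i\<close> hold exactly on the free ring. With
  \<open>a = x\<^sub>i - x\<^sub>i\<^sub>+\<^sub>1\<close> and \<open>b = x\<^sub>i\<^sub>+\<^sub>1 - x\<^sub>i\<^sub>+\<^sub>2\<close> they reduce the braid relation for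
  the \<open>T\<^sub>i\<close> to the identity \<open>a (a + b) b = b (a + b) a\<close> between skew polynomials
  (\<open>free_T_braid\<close>, \<open>letter_diff_braid\<close>), which holds because \<open>a\<^sup>2\<close> and \<open>b\<^sup>2\<close> are
  central in the ring generated by these three variables.\<close>

(* Index sets such as {1..n} should keep this form under simplification. *)
declare One_nat_def [simp del]

section \<open>Additive maps on the free ring\<close>

lemma free_ring_diff:
  assumes "p \<in> carrier (free_ring S)" "q \<in> carrier (free_ring S)"
  shows "p - q \<in> carrier (free_ring S)"
  using assms keys_diff[of p q] unfolding in_free_ring_iff by blast

lemma free_ring_uminus: "p \<in> carrier (free_ring S) \<Longrightarrow> - p \<in> carrier (free_ring S)"
  by (simp add: in_free_ring_iff)

lemma free_ring_zero: "0 \<in> carrier (free_ring S)"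
  and free_ring_one: "1 \<in> carrier (free_ring S)"
  by (simp_all add: in_free_ring_iff)

lemma free_ring_letter: "j \<in> S \<Longrightarrow> letter j \<in> carrier (free_ring S)"
  by (simp add: in_free_ring_iff letter_def)

lemmas free_ring_closed =
  free_ring_plus free_ring_times free_ring_diff free_ring_uminus free_ring_zero free_ring_one
  free_ring_letter

lemma frag_of_Word_Nil: "frag_of (Word []) = 1"
  by (metis single_one zero_word_def)

lemma frag_of_Word_Cons: "frag_of (Word (j # w)) = letter j * frag_of (Word w)"
  by (simp add: letter_def mult_single plus_word_def)

lemma free_ring_induct [consumes 1, case_names one letter diff]:
  assumes "p \<in> carrier (free_ring S)"
    and one: "P 1"
    and letter: "\<And>j q. j \<in> S \<Longrightarrow> q \<in> carrier (free_ring S) \<Longrightarrow> P q \<Longrightarrow> P (letter j * q)"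
    and diff: "\<And>q r. q \<in> carrier (free_ring S) \<Longrightarrow> r \<in> carrier (free_ring S) \<Longrightarrow>
      P q \<Longrightarrow> P r \<Longrightarrow> P (q - r)"
  shows "P p"
proof -
  have word: "frag_of (Word w) \<in> carrier (free_ring S) \<and> P (frag_of (Word w))"
    if "set w \<subseteq> S" for w
    using that
  proof (induction w)
    case Nil
    then show ?case by (simp add: frag_of_Word_Nil one free_ring_one)
  next
    case (Cons j w)
    then show ?case by (simp add: frag_of_Word_Cons letter free_ring_closed)
  qed
  have "Poly_Mapping.keys p \<subseteq> {w. set (letters w) \<subseteq> S}"
    using assms(1) by (auto simp: in_free_ring_iff)
  then have "p \<in> carrier (free_ring S) \<and> P p"
  proof (induction p rule: frag_induction)
    case zero
    show ?case using diff[of 1 1] one by (simp add: free_ring_closed)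
  next
    case (one w)
    then show ?case using word[of "letters w"] by simp
  next
    case (diff q r)
    then show ?case using assms(4)[of q r] by (simp add: free_ring_closed)
  qed
  then show ?thesis ..
qed

lemma free_ring_UNIV_induct [case_names one letter diff]:
  assumes "P 1" "\<And>j q. P q \<Longrightarrow> P (letter j * q)" "\<And>q r. P q \<Longrightarrow> P r \<Longrightarrow> P (q - r)"
  shows "P p"
  by (rule free_ring_induct[of p UNIV]) (use assms in \<open>auto simp: in_free_ring_iff\<close>)

text \<open>Operators are built on the whole free ring, where they satisfy exact identities that can be
  checked on words, and only then pass to quotients.\<close>

definition additive_map :: "((word \<Rightarrow>\<^sub>0 int) \<Rightarrow> word \<Rightarrow>\<^sub>0 int) \<Rightarrow> bool" where
  "additive_map L \<longleftrightarrow> (\<forall>p q. L (p + q) = L p + L q)"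

lemma additiveD:
  assumes "additive_map L"
  shows "L (p - q) = L p - L q" "L 0 = 0" "L (- p) = - L p" "L (p + q) = L p + L q"
proof -
  have plus: "\<And>p q. L (p + q) = L p + L q"
    using assms by (simp add: additive_map_def)
  then show "L (p + q) = L p + L q" .
  show zero: "L 0 = 0" using plus[of 0 0] by simp
  show "L (p - q) = L p - L q" using plus[of "p - q" q] by simp
  show "L (- p) = - L p" using plus[of "- p" p] zero by (simp add: eq_neg_iff_add_eq_0)
qed

text \<open>The value at a word of the additive map \<open>L\<close> given by \<open>L 1 = c\<close> and
  \<open>L (x\<^sub>j p) = d\<^sub>j p + a\<^sub>j L p\<close>. With \<open>d = 0\<close>, \<open>c = 1\<close> this is the substitution
  \<open>x\<^sub>j \<mapsto> a\<^sub>j\<close>; with \<open>c = 0\<close> it is the derivation twisted by that substitution which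
  sends \<open>x\<^sub>j\<close> to \<open>d\<^sub>j\<close>.\<close>

fun skew_word :: "(nat \<Rightarrow> word \<Rightarrow>\<^sub>0 int) \<Rightarrow> (nat \<Rightarrow> word \<Rightarrow>\<^sub>0 int) \<Rightarrow> (word \<Rightarrow>\<^sub>0 int) \<Rightarrow>
    nat list \<Rightarrow> word \<Rightarrow>\<^sub>0 int" where
  "skew_word a d c [] = c"
| "skew_word a d c (j # w) = d j * frag_of (Word w) + a j * skew_word a d c w"

definition skew_map :: "(nat \<Rightarrow> word \<Rightarrow>\<^sub>0 int) \<Rightarrow> (nat \<Rightarrow> word \<Rightarrow>\<^sub>0 int) \<Rightarrow> (word \<Rightarrow>\<^sub>0 int) \<Rightarrow>
    (word \<Rightarrow>\<^sub>0 int) \<Rightarrow> word \<Rightarrow>\<^sub>0 int" where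
  "skew_map a d c = frag_extend (\<lambda>w. skew_word a d c (letters w))"

lemma additive_skew_map: "additive_map (skew_map a d c)"
  by (simp add: additive_map_def skew_map_def frag_extend_add)

lemmas skew_map_simps = additiveD[OF additive_skew_map]

lemma skew_map_one [simp]: "skew_map a d c 1 = c"
  unfolding frag_of_Word_Nil[symmetric] skew_map_def by simp

lemma skew_map_letter:
  "skew_map a d c (letter j * p) = d j * p + a j * skew_map a d c p"
proof -
  have "Poly_Mapping.keys p \<subseteq> UNIV" by simp
  then show ?thesis
  proof (induction p rule: frag_induction)
    case zero
    show ?case by (simp add: skew_map_simps)
  next
    case (one w)
    have "letter j * frag_of w = frag_of (Word (j # letters w))"
      by (cases w) (simp add: frag_of_Word_Cons)
    then show ?case by (simp add: skew_map_def)
  next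
    case (diff p q)
    then show ?case by (simp add: skew_map_simps right_diff_distrib)
  qed
qed

lemma skew_map_closed:
  assumes "p \<in> carrier (free_ring S)" "c \<in> carrier (free_ring S)"
    and "\<And>j. j \<in> S \<Longrightarrow> a j \<in> carrier (free_ring S)"
    and "\<And>j. j \<in> S \<Longrightarrow> d j \<in> carrier (free_ring S)"
  shows "skew_map a d c p \<in> carrier (free_ring S)"
  using assms(1)
  by (induction p rule: free_ring_induct)
    (simp_all add: assms skew_map_letter skew_map_simps free_ring_closed)

definition subst_map :: "(nat \<Rightarrow> word \<Rightarrow>\<^sub>0 int) \<Rightarrow> (word \<Rightarrow>\<^sub>0 int) \<Rightarrow> word \<Rightarrow>\<^sub>0 int" where
  "subst_map a = skew_map a (\<lambda>_. 0) 1"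

definition skew_deriv :: "(nat \<Rightarrow> word \<Rightarrow>\<^sub>0 int) \<Rightarrow> (nat \<Rightarrow> word \<Rightarrow>\<^sub>0 int) \<Rightarrow>
    (word \<Rightarrow>\<^sub>0 int) \<Rightarrow> word \<Rightarrow>\<^sub>0 int" where
  "skew_deriv a d = skew_map a d 0"

lemma subst_map_simps:
  "subst_map a (p - q) = subst_map a p - subst_map a q" "subst_map a 0 = 0"
  "subst_map a (- p) = - subst_map a p" "subst_map a (p + q) = subst_map a p + subst_map a q"
  "subst_map a 1 = 1" "subst_map a (letter j * p) = a j * subst_map a p"
  by (simp_all add: subst_map_def skew_map_simps skew_map_letter)

lemma skew_deriv_simps:
  "skew_deriv a d (p - q) = skew_deriv a d p - skew_deriv a d q" "skew_deriv a d 0 = 0"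
  "skew_deriv a d (- p) = - skew_deriv a d p"
  "skew_deriv a d (p + q) = skew_deriv a d p + skew_deriv a d q"
  "skew_deriv a d 1 = 0" "skew_deriv a d (letter j * p) = d j * p + a j * skew_deriv a d p"
  by (simp_all add: skew_deriv_def skew_map_simps skew_map_letter)

lemma subst_map_mult: "subst_map a (p * q) = subst_map a p * subst_map a q"
  by (induction p rule: free_ring_UNIV_induct)
    (simp_all add: subst_map_simps mult.assoc left_diff_distrib)

lemma skew_deriv_mult:
  "skew_deriv a d (p * q) = skew_deriv a d p * q + subst_map a p * skew_deriv a d q"
  by (induction p rule: free_ring_UNIV_induct)
    (simp_all add: skew_deriv_simps subst_map_simps algebra_simps)

lemma subst_map_letter [simp]: "subst_map a (letter j) = a j"
  using subst_map_simps(6)[of a j 1] by (simp add: subst_map_simps)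

lemma skew_deriv_letter [simp]: "skew_deriv a d (letter j) = d j"
  using skew_deriv_simps(6)[of a d j 1] by (simp add: skew_deriv_simps)

text \<open>The representation of the free ring in which the letter \<open>j\<close> acts as \<open>T j\<close>.\<close>

definition word_act :: "(nat \<Rightarrow> (word \<Rightarrow>\<^sub>0 int) \<Rightarrow> word \<Rightarrow>\<^sub>0 int) \<Rightarrow>
    (word \<Rightarrow>\<^sub>0 int) \<Rightarrow> (word \<Rightarrow>\<^sub>0 int) \<Rightarrow> word \<Rightarrow>\<^sub>0 int" where
  "word_act T p g = frag_extend (\<lambda>w. foldr T (letters w) g) p"

lemma word_act_diff: "word_act T (p - q) g = word_act T p g - word_act T q g"
  by (simp add: word_act_def frag_extend_diff)

lemma word_act_zero: "word_act T 0 g = 0"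
  by (simp add: word_act_def)

lemma word_act_one: "word_act T 1 g = g"
  unfolding frag_of_Word_Nil[symmetric] word_act_def by simp

lemma word_act_plus: "word_act T (p + q) g = word_act T p g + word_act T q g"
  by (simp add: word_act_def frag_extend_add)

lemma word_act_letter_mult:
  assumes "\<And>j. additive_map (T j)"
  shows "word_act T (letter j * p) g = T j (word_act T p g)"
proof -
  have "Poly_Mapping.keys p \<subseteq> UNIV" by simp
  then show ?thesis
  proof (induction p rule: frag_induction)
    case zero
    show ?case by (simp add: word_act_zero additiveD[OF assms])
  next
    case (one w)
    have "letter j * frag_of w = frag_of (Word (j # letters w))"
      by (cases w) (simp add: frag_of_Word_Cons)
    then show ?case by (simp add: word_act_def)
  next
    case (diff p q)
    then show ?case by (simp add: right_diff_distrib word_act_diff additiveD[OF assms])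
  qed
qed

lemma word_act_letter:
  assumes "\<And>j. additive_map (T j)"
  shows "word_act T (letter j) g = T j g"
  using word_act_letter_mult[OF assms, where j = j and p = 1] by (simp add: word_act_one)

lemma word_act_mult:
  assumes "\<And>j. additive_map (T j)"
  shows "word_act T (p * q) g = word_act T p (word_act T q g)"
  by (induction p rule: free_ring_UNIV_induct)
    (simp_all add: word_act_one word_act_letter_mult[OF assms] mult.assoc left_diff_distrib
      word_act_diff)

lemma additive_word_act:
  assumes "\<And>j. additive_map (T j)"
  shows "additive_map (word_act T p)"
  unfolding additive_map_def
  by (rule allI, rule allI, induction p rule: free_ring_UNIV_induct)
    (simp_all add: word_act_one word_act_letter_mult[OF assms] word_act_diff
      additiveD[OF assms])

lemma word_act_preserves:
  assumes "\<And>j. additive_map (T j)" "p \<in> carrier (free_ring S)" "g \<in> K"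
    and "\<And>j g. j \<in> S \<Longrightarrow> g \<in> K \<Longrightarrow> T j g \<in> K"
    and "\<And>g h. g \<in> K \<Longrightarrow> h \<in> K \<Longrightarrow> g - h \<in> K"
  shows "word_act T p g \<in> K"
  using assms(2)
  by (induction p rule: free_ring_induct)
    (simp_all add: word_act_one word_act_letter_mult[OF assms(1)] word_act_diff assms)

section \<open>Odd divided differences on the free ring\<close>

definition swap_adj :: "nat \<Rightarrow> nat \<Rightarrow> nat" where
  "swap_adj i j = (if j = i then i + 1 else if j = i + 1 then i else j)"

definition free_s :: "nat \<Rightarrow> (word \<Rightarrow>\<^sub>0 int) \<Rightarrow> word \<Rightarrow>\<^sub>0 int" where
  "free_s i = subst_map (\<lambda>j. - letter (swap_adj i j))"

definition free_dd :: "nat \<Rightarrow> (word \<Rightarrow>\<^sub>0 int) \<Rightarrow> word \<Rightarrow>\<^sub>0 int" where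
  "free_dd i = skew_deriv (\<lambda>j. - letter (swap_adj i j)) (\<lambda>j. if j \<in> {i, i + 1} then 1 else 0)"

lemma free_dd_letter_mult:
  "free_dd i (letter j * p) = (if j \<in> {i, i + 1} then p else 0)
    - letter (swap_adj i j) * free_dd i p"
  by (simp add: free_dd_def skew_deriv_simps)

lemma free_dd_simps:
  "free_dd i (p - q) = free_dd i p - free_dd i q" "free_dd i 0 = 0"
  "free_dd i (- p) = - free_dd i p" "free_dd i (p + q) = free_dd i p + free_dd i q"
  "free_dd i 1 = 0"
  by (simp_all add: free_dd_def skew_deriv_simps)

text \<open>Applying the operator twice to \<open>x\<^sub>j p\<close> gives \<open>x\<^sub>j\<close> times applying it twice to
  \<open>p\<close>: the two inhomogeneous terms cancel because \<open>s\<^sub>i\<close> preserves \<open>{i, i + 1}\<close> and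
  changes the sign. So the identity holds on the free ring, by induction on words.\<close>

lemma free_dd_twice: "free_dd i (free_dd i p) = 0"
  by (induction p rule: free_ring_UNIV_induct)
    (auto simp: free_dd_simps free_dd_letter_mult swap_adj_def)

lemma free_dd_anticommute:
  assumes "i + 1 < j \<or> j + 1 < i"
  shows "free_dd i (free_dd j p) = - free_dd j (free_dd i p)"
proof (induction p rule: free_ring_UNIV_induct)
  case (letter k p)
  consider "k \<in> {i, i + 1}" | "k \<in> {j, j + 1}" | "k \<notin> {i, i + 1}" "k \<notin> {j, j + 1}" by blast
  then show ?case
    using assms letter by cases (auto simp: free_dd_simps free_dd_letter_mult swap_adj_def)
qed (simp_all add: free_dd_simps)

text \<open>The difference of the two sides kills \<open>1\<close>. When it is moved past a left factor \<open>x\<^sub>k\<close>, the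
  terms that do not begin with a letter cancel with the help of \<open>\<partial>\<^sub>i\<^sup>2 = 0\<close>, and the factor
  becomes \<open>- x\<^sub>l\<close> with \<open>l\<close> the image of \<open>k\<close> under the exchange of \<open>i\<close> and
  \<open>i + 2\<close>.\<close>

lemma free_dd_braid:
  "free_dd i (free_dd (i + 1) (free_dd i p)) = free_dd (i + 1) (free_dd i (free_dd (i + 1) p))"
proof (induction p rule: free_ring_UNIV_induct)
  case (letter k p)
  consider "k = i" | "k = i + 1" | "k = i + 2" | "k \<notin> {i, i + 1, i + 2}" by blast
  then show ?case
    using letter
    by cases (simp_all add: free_dd_simps free_dd_letter_mult swap_adj_def free_dd_twice)
qed (simp_all add: free_dd_simps)

abbreviation letter_diff :: "nat \<Rightarrow> word \<Rightarrow>\<^sub>0 int" where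
  "letter_diff i \<equiv> letter i - letter (i + 1)"

text \<open>The operator \<open>T\<^sub>i - 1\<close>; the quadratic relation says that it squares to zero.\<close>

definition nil_part :: "nat \<Rightarrow> (word \<Rightarrow>\<^sub>0 int) \<Rightarrow> word \<Rightarrow>\<^sub>0 int" where
  "nil_part i p = letter_diff i * free_dd i p"

lemma nil_part_simps:
  "nil_part i (p - q) = nil_part i p - nil_part i q" "nil_part i 0 = 0"
  "nil_part i (- p) = - nil_part i p" "nil_part i (p + q) = nil_part i p + nil_part i q"
  by (simp_all add: nil_part_def free_dd_simps algebra_simps)

text \<open>Both letters of \<open>x\<^sub>i - x\<^sub>i\<^sub>+\<^sub>1\<close> have odd divided difference \<open>1\<close>, and
  \<open>s\<^sub>i\<close> fixes this difference. So \<open>\<partial>\<^sub>i\<close> commutes with multiplication by it, and the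
  claim reduces to \<open>\<partial>\<^sub>i\<^sup>2 = 0\<close>.\<close>

lemma nil_part_twice: "nil_part i (nil_part i p) = 0"
  by (simp add: nil_part_def free_dd_simps free_dd_letter_mult left_diff_distrib swap_adj_def
      free_dd_twice)

lemma nil_part_far:
  assumes "i + 1 < j \<or> j + 1 < i"
  shows "nil_part i (nil_part j p) - nil_part j (nil_part i p) =
    - (letter_diff i * letter_diff j + letter_diff j * letter_diff i) * free_dd i (free_dd j p)"
proof -
  have far: "swap_adj i j = j" "swap_adj i (j + 1) = j + 1"
      "swap_adj j i = i" "swap_adj j (i + 1) = i + 1"
      "j \<notin> {i, i + 1}" "j + 1 \<notin> {i, i + 1}" "i \<notin> {j, j + 1}" "i + 1 \<notin> {j, j + 1}"
    using assms by (auto simp: swap_adj_def)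
  have *: "free_dd i (letter_diff j * q) = - (letter_diff j * free_dd i q)"
      "free_dd j (letter_diff i * q) = - (letter_diff i * free_dd j q)" for q
    using far by (simp_all add: left_diff_distrib free_dd_simps free_dd_letter_mult)
  show ?thesis
    unfolding nil_part_def * free_dd_anticommute[OF assms]
    by (simp add: algebra_simps)
qed

text \<open>Writing \<open>A\<close>, \<open>B\<close> for the square-zero operators \<open>T\<^sub>i - 1\<close>, \<open>T\<^sub>i\<^sub>+\<^sub>1 - 1\<close>,
  the braid relation amounts to \<open>A B A + A = B A B + B\<close>. Moving all divided differences to the
  right turns each side into a cubic polynomial times a threefold divided difference. The cubics,
  \<open>a (a + b) b\<close> and \<open>b (a + b) a\<close> up to sign, are different in
  the free ring and agree for anticommuting letters.\<close>

lemma nil_part_braid: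
  fixes i :: nat
  defines "a \<equiv> letter_diff i" and "b \<equiv> letter_diff (i + 1)"
  shows "nil_part i (nil_part (i + 1) (nil_part i p)) + nil_part i p =
      - (a * (a + b) * b) * free_dd i (free_dd (i + 1) (free_dd i p))"
    and "nil_part (i + 1) (nil_part i (nil_part (i + 1) p)) + nil_part (i + 1) p =
      - (b * (a + b) * a) * free_dd i (free_dd (i + 1) (free_dd i p))"
proof -
  have rules:
    "free_dd i (a * q) = a * free_dd i q"
    "free_dd i (b * q) = q - (a + b) * free_dd i q"
    "free_dd i ((a + b) * q) = q - b * free_dd i q"
    "free_dd (i + 1) (b * q) = b * free_dd (i + 1) q"
    "free_dd (i + 1) (a * q) = - q - (a + b) * free_dd (i + 1) q"
    "free_dd (i + 1) ((a + b) * q) = - q - a * free_dd (i + 1) q" for q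
    by (simp_all add: a_def b_def left_diff_distrib free_dd_simps free_dd_letter_mult swap_adj_def)
  have "nil_part i (nil_part (i + 1) (nil_part i p)) =
      a * free_dd i (b * free_dd (i + 1) (a * free_dd i p))"
    by (simp add: nil_part_def a_def b_def)
  also have "\<dots> = - (a * free_dd i p)
      - a * free_dd i (b * ((a + b) * free_dd (i + 1) (free_dd i p)))"
    by (simp add: rules free_dd_simps free_dd_twice right_diff_distrib)
  also have "a * free_dd i (b * ((a + b) * q)) = a * (a + b) * b * free_dd i q" for q
    unfolding rules by (simp add: algebra_simps)
  finally show "nil_part i (nil_part (i + 1) (nil_part i p)) + nil_part i p =
      - (a * (a + b) * b) * free_dd i (free_dd (i + 1) (free_dd i p))"
    by (simp add: nil_part_def a_def)
  have "nil_part (i + 1) (nil_part i (nil_part (i + 1) p)) =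
      b * free_dd (i + 1) (a * free_dd i (b * free_dd (i + 1) p))"
    by (simp add: nil_part_def a_def b_def)
  also have "\<dots> = - (b * free_dd (i + 1) p)
      - b * free_dd (i + 1) (a * ((a + b) * free_dd i (free_dd (i + 1) p)))"
    by (simp add: rules free_dd_simps free_dd_twice right_diff_distrib)
  also have "b * free_dd (i + 1) (a * ((a + b) * q)) = b * (a + b) * a * free_dd (i + 1) q" for q
    unfolding rules by (simp add: algebra_simps)
  finally show "nil_part (i + 1) (nil_part i (nil_part (i + 1) p)) + nil_part (i + 1) p =
      - (b * (a + b) * a) * free_dd i (free_dd (i + 1) (free_dd i p))"
    by (simp only: free_dd_braid) (simp add: nil_part_def b_def)
qed

definition free_T :: "nat \<Rightarrow> (word \<Rightarrow>\<^sub>0 int) \<Rightarrow> word \<Rightarrow>\<^sub>0 int" where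
  "free_T i p = p + nil_part i p"

lemma additive_free_T: "additive_map (free_T i)"
  by (simp add: additive_map_def free_T_def nil_part_simps)

lemma free_T_eq: "free_T i p = free_dd i (letter i * p) + letter i * free_dd i p"
  by (simp add: free_T_def nil_part_def free_dd_letter_mult swap_adj_def left_diff_distrib)

lemma free_T_quadratic: "free_T i (free_T i p) = 2 * free_T i p - p"
  by (simp add: free_T_def nil_part_simps nil_part_twice mult_2)

lemma free_T_far:
  "free_T i (free_T j p) - free_T j (free_T i p) =
    nil_part i (nil_part j p) - nil_part j (nil_part i p)"
  by (simp add: free_T_def nil_part_simps)

lemma free_T_braid:
  fixes i :: nat
  defines "a \<equiv> letter_diff i" and "b \<equiv> letter_diff (i + 1)"
  shows "free_T i (free_T (i + 1) (free_T i p)) - free_T (i + 1) (free_T i (free_T (i + 1) p)) =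
    (b * (a + b) * a - a * (a + b) * b) * free_dd i (free_dd (i + 1) (free_dd i p))"
proof -
  have "free_T i (free_T (i + 1) (free_T i p)) - free_T (i + 1) (free_T i (free_T (i + 1) p)) =
      (nil_part i (nil_part (i + 1) (nil_part i p)) + nil_part i p) -
      (nil_part (i + 1) (nil_part i (nil_part (i + 1) p)) + nil_part (i + 1) p)"
    by (simp add: free_T_def nil_part_simps nil_part_twice)
  then show ?thesis
    unfolding nil_part_braid a_def b_def by (simp add: algebra_simps)
qed

section \<open>A locally nilpotent left inverse of a variable\<close>

text \<open>On a word, this deletes the first occurrence of the letter \<open>i\<close>, with a sign for each letter it
  passes, and gives \<open>0\<close> if \<open>i\<close> does not occur. It inverts left multiplication by
  \<open>x\<^sub>i\<close>, anticommutes with left multiplication by the other letters, and respects the relations of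
  skew polynomials. With it,
  \<open>x\<^sub>i - x\<^sub>i\<^sub>+\<^sub>1\<close> can be cancelled without knowing a basis of the ring of skew
  polynomials.\<close>

definition signed_remove :: "nat \<Rightarrow> (word \<Rightarrow>\<^sub>0 int) \<Rightarrow> word \<Rightarrow>\<^sub>0 int" where
  "signed_remove i = skew_deriv (\<lambda>j. if j = i then 0 else - letter j) (\<lambda>j. if j = i then 1 else 0)"

lemma signed_remove_letter_mult:
  "signed_remove i (letter j * p) = (if j = i then p else - (letter j * signed_remove i p))"
  by (simp add: signed_remove_def skew_deriv_simps)

lemma signed_remove_simps:
  "signed_remove i (p - q) = signed_remove i p - signed_remove i q" "signed_remove i 0 = 0"
  "signed_remove i (- p) = - signed_remove i p"
  "signed_remove i (p + q) = signed_remove i p + signed_remove i q" "signed_remove i 1 = 0"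
  by (simp_all add: signed_remove_def skew_deriv_simps)

lemma signed_remove_funpow_zero: "(signed_remove i ^^ m) 0 = 0"
  by (induction m) (simp_all add: signed_remove_simps)

lemma signed_remove_funpow_diff:
  "(signed_remove i ^^ m) (p - q) = (signed_remove i ^^ m) p - (signed_remove i ^^ m) q"
  by (induction m) (simp_all add: signed_remove_simps)

text \<open>Each application removes an occurrence of \<open>i\<close> from every word.\<close>

lemma signed_remove_nilpotent: "\<exists>m. (signed_remove i ^^ m) p = 0"
proof (induction p rule: free_ring_UNIV_induct)
  case one
  have "(signed_remove i ^^ Suc 0) 1 = 0" by (simp add: signed_remove_simps)
  then show ?case ..
next
  case (letter j p)
  then obtain m where m: "(signed_remove i ^^ m) p = 0" ..
  show ?case
  proof (cases "j = i")
    case True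
    then have "(signed_remove i ^^ Suc m) (letter j * p) = 0"
      using m by (simp add: signed_remove_letter_mult funpow_Suc_right del: funpow.simps)
    then show ?thesis ..
  next
    case False
    have "(signed_remove i ^^ k) q = 0 \<Longrightarrow> (signed_remove i ^^ k) (letter j * q) = 0" for k q
    proof (induction k arbitrary: q)
      case (Suc k)
      have "(signed_remove i ^^ Suc k) (letter j * q) =
          (signed_remove i ^^ k) (0 - letter j * signed_remove i q)"
        using False by (simp add: funpow_Suc_right signed_remove_letter_mult del: funpow.simps)
      also have "\<dots> = 0"
        using Suc by (simp only: signed_remove_funpow_diff signed_remove_funpow_zero funpow_Suc_right
              o_apply) simp
      finally show ?case .
    qed (simp add: signed_remove_simps)
    then show ?thesis using m by blast
  qed
next
  case (diff p q)
  then obtain k m where km: "(signed_remove i ^^ k) p = 0" "(signed_remove i ^^ m) q = 0" by blast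
  have "(signed_remove i ^^ (k + m)) p = 0" "(signed_remove i ^^ (k + m)) q = 0"
    by (simp add: add.commute[of k m] funpow_add km signed_remove_funpow_zero)
      (simp add: funpow_add km signed_remove_funpow_zero)
  then have "(signed_remove i ^^ (k + m)) (p - q) = 0" by (simp add: signed_remove_funpow_diff)
  then show ?case ..
qed

section \<open>Operators on presented rings\<close>

locale presentation =
  fixes S :: "nat set" and E :: "(word \<Rightarrow>\<^sub>0 int) set"
  assumes relators: "E \<subseteq> carrier (free_ring S)"
begin

abbreviation F where "F \<equiv> carrier (free_ring S)"
abbreviation I where "I \<equiv> Idl\<^bsub>free_ring S\<^esub> E"
abbreviation Q where "Q \<equiv> presented_ring S E"
abbreviation cls where "cls p \<equiv> I +>\<^bsub>free_ring S\<^esub> p"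

lemma ideal_I: "ideal I (free_ring S)"
  by (rule ring.genideal_ideal[OF ring_free_ring relators])

lemma ring_Q: "ring Q"
  by (rule ring_presented_ring[OF relators])

lemma relator_in_I: "p \<in> E \<Longrightarrow> p \<in> I"
  using ring.genideal_self[OF ring_free_ring relators] by blast

lemma I_subset: "p \<in> I \<Longrightarrow> p \<in> F"
  by (rule additive_subgroup.a_Hcarr[OF ideal.axioms(1)[OF ideal_I]])

lemma I_zero: "0 \<in> I"
  using additive_subgroup.zero_closed[OF ideal.axioms(1)[OF ideal_I]]
  by (simp add: free_ring_simps)

lemma I_plus: "p \<in> I \<Longrightarrow> q \<in> I \<Longrightarrow> p + q \<in> I"
  using additive_subgroup.a_closed[OF ideal.axioms(1)[OF ideal_I]]
  by (simp add: free_ring_simps)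

lemma I_lmult: "p \<in> I \<Longrightarrow> q \<in> F \<Longrightarrow> q * p \<in> I"
  using ideal.I_l_closed[OF ideal_I] by (simp add: free_ring_simps)

lemma I_rmult: "p \<in> I \<Longrightarrow> q \<in> F \<Longrightarrow> p * q \<in> I"
  using ideal.I_r_closed[OF ideal_I] by (simp add: free_ring_simps)

lemma I_uminus: "p \<in> I \<Longrightarrow> - p \<in> I"
  using I_lmult[of p "- 1"] by (simp add: free_ring_closed)

lemma I_diff: "p \<in> I \<Longrightarrow> q \<in> I \<Longrightarrow> p - q \<in> I"
  using I_plus[of p "- q"] I_uminus by simp

lemmas I_closed = I_zero I_plus I_lmult I_rmult I_uminus I_diff

text \<open>The predicate may use membership in the ideal as a hypothesis; this is needed for twisted
  derivations, since the Leibniz rule on a product also involves the ideal element itself.\<close>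

lemma I_induct [consumes 1, case_names relator zero diff lmult rmult]:
  assumes "p \<in> I"
    and "\<And>e. e \<in> E \<Longrightarrow> P e" and "P 0"
    and "\<And>q r. q \<in> I \<Longrightarrow> r \<in> I \<Longrightarrow> P q \<Longrightarrow> P r \<Longrightarrow> P (q - r)"
    and "\<And>q r. q \<in> I \<Longrightarrow> r \<in> F \<Longrightarrow> P q \<Longrightarrow> P (r * q)"
    and "\<And>q r. q \<in> I \<Longrightarrow> r \<in> F \<Longrightarrow> P q \<Longrightarrow> P (q * r)"
  shows "P p"
proof -
  let ?K = "{q \<in> I. P q}"
  have um: "- q \<in> ?K" if "q \<in> ?K" for q
    using assms(3) assms(4)[of 0 q] that by (simp add: I_closed)
  have "ideal ?K (free_ring S)"
  proof (rule idealI[OF ring_free_ring])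
    show "subgroup ?K (add_monoid (free_ring S))"
    proof (rule group.subgroupI)
      show "group (add_monoid (free_ring S))"
        using abelian_group.a_group[OF ring.is_abelian_group[OF ring_free_ring]] .
      show "?K \<subseteq> carrier (add_monoid (free_ring S))" using I_subset by auto
      show "?K \<noteq> {}" using assms(3) I_zero by auto
      fix q assume q: "q \<in> ?K"
      have "inv\<^bsub>add_monoid (free_ring S)\<^esub> q = - q"
      proof (rule group.inv_equality)
        show "group (add_monoid (free_ring S))"
          using abelian_group.a_group[OF ring.is_abelian_group[OF ring_free_ring]] .
      qed (use q I_subset in \<open>simp_all add: free_ring_simps free_ring_closed\<close>)
      then show "inv\<^bsub>add_monoid (free_ring S)\<^esub> q \<in> ?K" using um[OF q] by simp
    next
      fix q r assume "q \<in> ?K" "r \<in> ?K"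
      then show "q \<otimes>\<^bsub>add_monoid (free_ring S)\<^esub> r \<in> ?K"
        using um[of r] assms(4)[of q "- r"] by (auto simp: free_ring_simps I_closed)
    qed
  qed (auto simp: free_ring_simps I_closed assms)
  then have "I \<subseteq> ?K"
    by (rule ring.genideal_minimal[OF ring_free_ring]) (auto simp: relator_in_I assms)
  then show ?thesis using assms(1) by blast
qed

lemma carrier_Q: "carrier Q = cls ` F"
  by (auto simp: presented_ring_def FactRing_def A_RCOSETS_def')

lemma cls_in_Q [simp]: "p \<in> F \<Longrightarrow> cls p \<in> carrier Q"
  by (simp add: carrier_Q)

lemma cls_eq_iff:
  assumes "p \<in> F" "q \<in> F"
  shows "cls p = cls q \<longleftrightarrow> p - q \<in> I"
proof -
  interpret ideal I "free_ring S" by (rule ideal_I)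
  have "q \<in> F \<Longrightarrow> \<ominus>\<^bsub>free_ring S\<^esub> q = - q"
    by (rule abelian_group.minus_equality[OF ring.is_abelian_group[OF ring_free_ring]])
      (simp_all add: free_ring_simps free_ring_closed)
  then have *: "p \<in> cls q \<longleftrightarrow> p - q \<in> I"
    using assms by (simp add: a_rcos_module free_ring_simps)
  show ?thesis
    using * a_repr_independence'[of p q] a_repr_independenceD[of p q] assms by auto
qed

lemma Q_add: "p \<in> F \<Longrightarrow> q \<in> F \<Longrightarrow> cls p \<oplus>\<^bsub>Q\<^esub> cls q = cls (p + q)"
  using ring_hom_add[OF ideal.rcos_ring_hom[OF ideal_I]]
  by (simp add: presented_ring_def free_ring_simps)

lemma Q_mult: "p \<in> F \<Longrightarrow> q \<in> F \<Longrightarrow> cls p \<otimes>\<^bsub>Q\<^esub> cls q = cls (p * q)"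
  using ring_hom_mult[OF ideal.rcos_ring_hom[OF ideal_I]]
  by (simp add: presented_ring_def free_ring_simps)

lemma Q_one: "\<one>\<^bsub>Q\<^esub> = cls 1"
  by (simp add: presented_ring_def FactRing_def free_ring_simps)

lemma cls_zero_iff: "p \<in> F \<Longrightarrow> cls p = \<zero>\<^bsub>Q\<^esub> \<longleftrightarrow> p \<in> I"
proof -
  assume p: "p \<in> F"
  have "\<zero>\<^bsub>Q\<^esub> = cls 0"
    using ring.a_rcos_zero[OF ring_free_ring ideal_I, of 0] I_zero
    by (simp add: presented_ring_def FactRing_def)
  then show ?thesis using cls_eq_iff[OF p free_ring_zero] by simp
qed

lemma Q_zero: "\<zero>\<^bsub>Q\<^esub> = cls 0"
  using cls_zero_iff[of 0] by (simp add: I_zero free_ring_closed)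

lemma Q_uminus: "p \<in> F \<Longrightarrow> \<ominus>\<^bsub>Q\<^esub> cls p = cls (- p)"
  by (rule abelian_group.minus_equality[OF ring.is_abelian_group[OF ring_Q]])
    (simp_all add: Q_add Q_zero free_ring_closed)

lemmas Q_simps = Q_add Q_mult Q_one Q_zero Q_uminus

text \<open>Uniqueness of all maps below: an additive map on a presented ring is determined by its value at
  \<open>1\<close> and its behaviour under left multiplication by generators.\<close>

lemma additive_eqI:
  assumes "abelian_group H"
    and "\<phi> \<in> hom (add_monoid Q) (add_monoid H)" "\<psi> \<in> hom (add_monoid Q) (add_monoid H)"
    and "\<phi> \<one>\<^bsub>Q\<^esub> = \<psi> \<one>\<^bsub>Q\<^esub>"
    and step: "\<And>j X. j \<in> S \<Longrightarrow> X \<in> carrier Q \<Longrightarrow> \<phi> X = \<psi> X \<Longrightarrow>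
      \<phi> (generator S E j \<otimes>\<^bsub>Q\<^esub> X) = \<psi> (generator S E j \<otimes>\<^bsub>Q\<^esub> X)"
    and "X \<in> carrier Q"
  shows "\<phi> X = \<psi> X"
proof -
  interpret H: abelian_group H by fact
  obtain p where p: "p \<in> F" "X = cls p" using assms(6) by (auto simp: carrier_Q)
  have "\<phi> (cls p) = \<psi> (cls p)"
    using p(1)
  proof (induction p rule: free_ring_induct)
    case one
    then show ?case using assms(4) by (simp add: Q_one)
  next
    case (letter j q)
    then show ?case
      using step[of j "cls q"] by (simp add: generator_def Q_mult free_ring_closed)
  next
    case (diff q r)
    have split: "\<theta> (cls (q - r)) \<oplus>\<^bsub>H\<^esub> \<theta> (cls r) = \<theta> (cls q)"
      if "\<theta> \<in> hom (add_monoid Q) (add_monoid H)" for \<theta>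
      using hom_mult[OF that, of "cls (q - r)" "cls r"] diff by (simp add: Q_add free_ring_closed)
    have "\<phi> (cls (q - r)) \<in> carrier H" "\<psi> (cls (q - r)) \<in> carrier H" "\<psi> (cls r) \<in> carrier H"
      using hom_in_carrier[OF assms(2)] hom_in_carrier[OF assms(3)] diff
      by (simp_all add: free_ring_closed)
    then show ?case
      using split[OF assms(2)] split[OF assms(3)] diff.IH H.add.right_cancel by metis
  qed
  then show ?thesis using p by simp
qed

definition descend :: "((word \<Rightarrow>\<^sub>0 int) \<Rightarrow> 'b) \<Rightarrow> (word \<Rightarrow>\<^sub>0 int) set \<Rightarrow> 'b" where
  "descend \<phi> = (\<lambda>X\<in>carrier Q. \<phi> (SOME p. p \<in> F \<and> cls p = X))"

lemma descend_extensional: "descend \<phi> \<in> extensional (carrier Q)"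
  by (simp add: descend_def)

lemma descend_cls:
  assumes "p \<in> F" "\<And>p q. p \<in> F \<Longrightarrow> q \<in> F \<Longrightarrow> p - q \<in> I \<Longrightarrow> \<phi> p = \<phi> q"
  shows "descend \<phi> (cls p) = \<phi> p"
proof -
  let ?q = "SOME q. q \<in> F \<and> cls q = cls p"
  have "?q \<in> F \<and> cls ?q = cls p"
    by (rule someI[of _ p]) (simp add: assms)
  then have "\<phi> ?q = \<phi> p" using assms cls_eq_iff by blast
  then show ?thesis by (simp add: descend_def assms)
qed

definition compatible :: "((word \<Rightarrow>\<^sub>0 int) \<Rightarrow> word \<Rightarrow>\<^sub>0 int) \<Rightarrow> bool" where
  "compatible L \<longleftrightarrow> additive_map L \<and> (\<forall>p\<in>F. L p \<in> F) \<and> (\<forall>p\<in>I. L p \<in> I)"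

lemma compatibleD:
  assumes "compatible L"
  shows "additive_map L" "p \<in> F \<Longrightarrow> L p \<in> F" "p \<in> I \<Longrightarrow> L p \<in> I"
  using assms by (auto simp: compatible_def)

definition induced :: "((word \<Rightarrow>\<^sub>0 int) \<Rightarrow> word \<Rightarrow>\<^sub>0 int) \<Rightarrow>
    (word \<Rightarrow>\<^sub>0 int) set \<Rightarrow> (word \<Rightarrow>\<^sub>0 int) set" where
  "induced L = descend (\<lambda>p. cls (L p))"

lemma induced_extensional: "induced L \<in> extensional (carrier Q)"
  by (simp add: induced_def descend_extensional)

lemma induced_cls:
  assumes "compatible L" "p \<in> F"
  shows "induced L (cls p) = cls (L p)"
  unfolding induced_def
proof (rule descend_cls[OF assms(2)])
  fix p q assume "p \<in> F" "q \<in> F" "p - q \<in> I"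
  then show "cls (L p) = cls (L q)"
    using compatibleD[OF assms(1)] additiveD(1)[OF compatibleD(1)[OF assms(1)]]
    by (metis cls_eq_iff)
qed

lemma induced_hom:
  assumes "compatible L"
  shows "induced L \<in> hom (add_monoid Q) (add_monoid Q)"
  by (rule homI)
    (auto simp: carrier_Q induced_cls[OF assms] Q_add free_ring_closed compatibleD[OF assms]
      additiveD[OF compatibleD(1)[OF assms]])

lemma induced_unique:
  assumes "\<phi> \<in> extensional (carrier Q)" "compatible L" "\<And>p. p \<in> F \<Longrightarrow> \<phi> (cls p) = cls (L p)"
  shows "\<phi> = induced L"
  by (rule extensionalityI[OF assms(1) induced_extensional])
    (auto simp: carrier_Q induced_cls assms)

lemma compatible_subst_map:
  assumes a: "\<And>j. j \<in> S \<Longrightarrow> a j \<in> F"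
    and E: "\<And>e. e \<in> E \<Longrightarrow> subst_map a e \<in> I"
  shows "compatible (subst_map a)"
proof -
  have F: "subst_map a p \<in> F" if "p \<in> F" for p
    unfolding subst_map_def by (rule skew_map_closed) (simp_all add: that a free_ring_closed)
  have "subst_map a p \<in> I" if "p \<in> I" for p
    using that
    by (induction p rule: I_induct)
      (simp_all add: E F subst_map_simps subst_map_mult I_closed)
  then show ?thesis
    using F by (simp add: compatible_def additive_map_def subst_map_simps)
qed

text \<open>Leibniz: on a product with a factor in the ideal, \<open>D (p q) = D p q + s p D q\<close> lies in the ideal
  if \<open>s\<close> and \<open>D\<close> preserve it on that factor. So only the relators have to be checked.\<close>

lemma compatible_skew_deriv:
  assumes a: "\<And>j. j \<in> S \<Longrightarrow> a j \<in> F" and d: "\<And>j. j \<in> S \<Longrightarrow> d j \<in> F"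
    and E: "\<And>e. e \<in> E \<Longrightarrow> subst_map a e \<in> I" "\<And>e. e \<in> E \<Longrightarrow> skew_deriv a d e \<in> I"
  shows "compatible (skew_deriv a d)"
proof -
  have F: "skew_deriv a d p \<in> F" if "p \<in> F" for p
    unfolding skew_deriv_def by (rule skew_map_closed) (simp_all add: that a d free_ring_closed)
  note s = compatibleD[OF compatible_subst_map[OF a E(1)]]
  have "skew_deriv a d p \<in> I" if "p \<in> I" for p
    using that
    by (induction p rule: I_induct)
      (simp_all add: E F s skew_deriv_simps skew_deriv_mult I_closed)
  then show ?thesis
    using F by (simp add: compatible_def additive_map_def skew_deriv_simps)
qed

end

section \<open>Skew polynomials as a presented ring\<close>

lemma opol_relators_closed: "opol_relators n \<subseteq> carrier (free_ring {1..n})"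
  by (auto simp: opol_relators_def free_ring_closed)

interpretation opol: presentation "{1..n}" "opol_relators n" for n
  by (simp add: presentation_def opol_relators_closed)

lemma letters_anticommute:
  assumes "j \<in> {1..n}" "k \<in> {1..n}" "j \<noteq> k"
  shows "letter j * letter k + letter k * letter j \<in> opol.I n"
  using assms by (intro opol.relator_in_I) (auto simp: opol_relators_def)

lemma swap_adj_range: "i \<in> {1..<n} \<Longrightarrow> j \<in> {1..n} \<Longrightarrow> swap_adj i j \<in> {1..n}"
  by (auto simp: swap_adj_def)

lemma swap_adj_eq_iff: "swap_adj i j = swap_adj i k \<longleftrightarrow> j = k"
  by (auto simp: swap_adj_def)

lemma subst_swap_adj_relator:
  assumes "i \<in> {1..<n}" "e \<in> opol_relators n"
  shows "subst_map (\<lambda>j. - letter (swap_adj i j)) e \<in> opol.I n"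
proof -
  obtain j k where jk: "e = letter j * letter k + letter k * letter j"
      "j \<in> {1..n}" "k \<in> {1..n}" "j \<noteq> k"
    using assms(2) by (auto simp: opol_relators_def)
  show ?thesis
    using letters_anticommute[of "swap_adj i j" n "swap_adj i k"] swap_adj_range[OF assms(1)] jk
    by (simp add: subst_map_simps swap_adj_eq_iff)
qed

lemma compatible_free_s:
  assumes "i \<in> {1..<n}"
  shows "opol.compatible n (free_s i)"
  unfolding free_s_def using swap_adj_range[OF assms] subst_swap_adj_relator[OF assms]
  by (intro opol.compatible_subst_map) (simp_all add: free_ring_closed)

lemma compatible_free_dd:
  assumes "i \<in> {1..<n}"
  shows "opol.compatible n (free_dd i)"
  unfolding free_dd_def
proof (rule opol.compatible_skew_deriv)
  fix e assume "e \<in> opol_relators n"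
  then obtain j k where "e = letter j * letter k + letter k * letter j" "j \<noteq> k"
    by (auto simp: opol_relators_def)
  then have "skew_deriv (\<lambda>j. - letter (swap_adj i j)) (\<lambda>j. if j \<in> {i, i + 1} then 1 else 0) e = 0"
    by (auto simp: skew_deriv_simps swap_adj_def)
  then show "skew_deriv (\<lambda>j. - letter (swap_adj i j)) (\<lambda>j. if j \<in> {i, i + 1} then 1 else 0) e
      \<in> opol.I n"
    by (simp add: opol.I_zero)
qed (use swap_adj_range[OF assms] subst_swap_adj_relator[OF assms] in \<open>simp_all add: free_ring_closed\<close>)

lemma compatible_signed_remove: "opol.compatible n (signed_remove i)"
  unfolding signed_remove_def
proof (rule opol.compatible_skew_deriv)
  fix e assume e: "e \<in> opol_relators n"
  then obtain j k where jk: "e = letter j * letter k + letter k * letter j"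
      "j \<in> {1..n}" "k \<in> {1..n}" "j \<noteq> k"
    by (auto simp: opol_relators_def)
  show "subst_map (\<lambda>j. if j = i then 0 else - letter j) e \<in> opol.I n"
    using letters_anticommute[OF jk(2-4)] jk by (auto simp: subst_map_simps opol.I_zero)
  have "skew_deriv (\<lambda>j. if j = i then 0 else - letter j) (\<lambda>j. if j = i then 1 else 0) e = 0"
    using jk by (auto simp: skew_deriv_simps)
  then show "skew_deriv (\<lambda>j. if j = i then 0 else - letter j) (\<lambda>j. if j = i then 1 else 0) e
      \<in> opol.I n"
    by (simp add: opol.I_zero)
qed (auto simp: free_ring_closed)

lemma letter_diff_closed: "i \<in> {1..<n} \<Longrightarrow> letter_diff i \<in> opol.F n"
  by (simp add: free_ring_closed)

text \<open>Apply \<open>\<theta>\<close>, the signed removal of \<open>i\<close>, to \<open>(x\<^sub>i - y) g = 0\<close> with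
  \<open>y = x\<^sub>i\<^sub>+\<^sub>1\<close>. As \<open>\<theta> x\<^sub>i = 1\<close> and \<open>\<theta> y = - y \<theta>\<close>, this gives
  \<open>g = - y \<theta> g\<close>. Applying \<open>\<theta>\<close> repeatedly, \<open>g\<close> is up to sign
  \<open>y\<^sup>m \<theta>\<^sup>m g\<close> for every \<open>m\<close>, which vanishes for large \<open>m\<close>.\<close>

lemma letter_diff_cancel:
  assumes "i \<in> {1..<n}" "g \<in> opol.F n" "letter_diff i * g \<in> opol.I n"
  shows "g \<in> opol.I n"
proof -
  note th = opol.compatibleD[OF compatible_signed_remove[of n i]]
  let ?y = "letter (i + 1)"
  have y: "?y \<in> opol.F n" using assms(1) by (simp add: free_ring_closed)
  \<comment> \<open>Each application of the removal operator changes the sign of the relation, so both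
    signs are carried along.\<close>
  have key: "h \<in> opol.I n"
    if "(signed_remove i ^^ m) h = 0" "h \<in> opol.F n"
      "h + ?y * signed_remove i h \<in> opol.I n \<or> h - ?y * signed_remove i h \<in> opol.I n" for m h
    using that
  proof (induction m arbitrary: h)
    case 0
    then show ?case by (simp add: opol.I_zero)
  next
    case (Suc m)
    have "signed_remove i h - ?y * signed_remove i (signed_remove i h) \<in> opol.I n \<or>
        signed_remove i h + ?y * signed_remove i (signed_remove i h) \<in> opol.I n"
      using Suc.prems(3) th(3)[of "h + ?y * signed_remove i h"] th(3)[of "h - ?y * signed_remove i h"]
      by (auto simp: signed_remove_simps signed_remove_letter_mult)
    then have "signed_remove i h \<in> opol.I n"
      using Suc.prems Suc.IH[of "signed_remove i h"] th(2)
      by (auto simp: funpow_Suc_right simp del: funpow.simps)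
    then have "?y * signed_remove i h \<in> opol.I n"
      using y by (rule opol.I_lmult)
    then show ?case
      using Suc.prems(3) opol.I_diff[of "h + ?y * signed_remove i h" n "?y * signed_remove i h"]
        opol.I_plus[of "h - ?y * signed_remove i h" n "?y * signed_remove i h"] by auto
  qed
  obtain m where "(signed_remove i ^^ m) g = 0" using signed_remove_nilpotent by blast
  moreover have "signed_remove i (letter_diff i * g) = g + ?y * signed_remove i g"
    by (simp add: left_diff_distrib signed_remove_simps signed_remove_letter_mult)
  ultimately show ?thesis using key assms(2) th(3)[OF assms(3)] by auto
qed

lemma letter_diff_anticommute:
  assumes "i \<in> {1..<n}" "j \<in> {1..<n}" "i + 1 < j \<or> j + 1 < i"
  shows "letter_diff i * letter_diff j + letter_diff j * letter_diff i \<in> opol.I n"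
proof -
  let ?r = "\<lambda>k l. letter k * letter l + letter l * letter k"
  have "letter_diff i * letter_diff j + letter_diff j * letter_diff i =
      ?r i j - ?r i (j + 1) - ?r (i + 1) j + ?r (i + 1) (j + 1)"
    by (simp add: algebra_simps)
  also have "\<dots> \<in> opol.I n"
    using assms by (intro opol.I_plus opol.I_diff letters_anticommute) auto
  finally show ?thesis .
qed

text \<open>Both cubics expand to \<open>a\<^sup>2 b + a b\<^sup>2\<close> up to commuting a square past a linear form. This is
  possible because, for anticommuting letters, \<open>a\<^sup>2\<close> and \<open>b\<^sup>2\<close> are sums of squares of letters, and
  those are central. The proof records the resulting difference as an explicit combination of the
  relators \<open>u\<close>, \<open>v\<close>, \<open>w\<close>.\<close>

lemma letter_diff_braid:
  fixes i :: nat
  defines "a \<equiv> letter_diff i" and "b \<equiv> letter_diff (i + 1)"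
  assumes "i \<in> {1..<n}" "i + 1 \<in> {1..<n}"
  shows "b * (a + b) * a - a * (a + b) * b \<in> opol.I n"
proof -
  define x y z where "x = letter i" and "y = letter (i + 1)" and "z = letter (i + 1 + 1)"
  define u v w where "u = x * y + y * x" and "v = y * z + z * y" and "w = x * z + z * x"
  have F: "x \<in> opol.F n" "y \<in> opol.F n" "z \<in> opol.F n"
    using assms by (simp_all add: x_def y_def z_def free_ring_closed)
  have I: "u \<in> opol.I n" "v \<in> opol.I n" "w \<in> opol.I n"
    using assms unfolding u_def v_def w_def x_def y_def z_def
    by (auto intro!: letters_anticommute)
  have ab: "a = x - y" "b = y - z"
    by (simp_all add: a_def b_def x_def y_def z_def)
  \<comment> \<open>Here \<open>a\<^sup>2 = x\<^sup>2 + y\<^sup>2 - u\<close> and \<open>b\<^sup>2 = y\<^sup>2 + z\<^sup>2 - v\<close>.\<close>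
  have "b * (a + b) * a - a * (a + b) * b =
      (b * (x * x) - (x * x) * b) + (b * (y * y) - (y * y) * b) - (b * u - u * b)
    + ((y * y) * a - a * (y * y)) + ((z * z) * a - a * (z * z)) - (v * a - a * v)"
    by (simp add: ab u_def v_def algebra_simps)
  \<comment> \<open>A commutator such as \<open>x\<^sup>2 y - y x\<^sup>2\<close> equals \<open>x u - u x\<close>.\<close>
  also have "\<dots> = - ((x * u - u * x) - (x * w - w * x)) + (y * v - v * y) - (b * u - u * b)
    + (y * u - u * y) + ((z * w - w * z) - (z * v - v * z)) - (v * a - a * v)"
    by (simp add: ab u_def v_def w_def algebra_simps)
  also have "\<dots> \<in> opol.I n"
    using F I by (simp add: ab opol.I_closed free_ring_closed)
  finally show ?thesis .
qed

section \<open>The operators on skew polynomials\<close>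

lemmas opol_simps = opol.Q_simps[folded OPol_def]
lemmas opol_carrier = opol.carrier_Q[folded OPol_def]
lemmas opol_in_carrier = opol.cls_in_Q[folded OPol_def]
lemmas ring_OPol = opol.ring_Q[folded OPol_def]

lemma opol_x_cls: "opol_x n j = opol.cls n (letter j)"
  by (simp add: opol_x_def generator_def)

lemma opol_additive_eqI:
  assumes "abelian_group H"
    and "\<phi> \<in> hom (add_monoid (OPol n)) (add_monoid H)"
      "\<psi> \<in> hom (add_monoid (OPol n)) (add_monoid H)"
    and "\<phi> \<one>\<^bsub>OPol n\<^esub> = \<psi> \<one>\<^bsub>OPol n\<^esub>"
    and "\<And>j X. j \<in> {1..n} \<Longrightarrow> X \<in> carrier (OPol n) \<Longrightarrow> \<phi> X = \<psi> X \<Longrightarrow>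
      \<phi> (opol_x n j \<otimes>\<^bsub>OPol n\<^esub> X) = \<psi> (opol_x n j \<otimes>\<^bsub>OPol n\<^esub> X)"
    and "X \<in> carrier (OPol n)"
  shows "\<phi> X = \<psi> X"
  using opol.additive_eqI[of H \<phi> n \<psi> X] assms unfolding OPol_def opol_x_def by blast

lemma ring_hom_additive: "h \<in> ring_hom R S \<Longrightarrow> h \<in> hom (add_monoid R) (add_monoid S)"
  by (auto simp: ring_hom_def hom_def)

lemma opol_s_eq:
  assumes i: "i \<in> {1..<n}"
  shows "opol_s n i = opol.induced n (free_s i)"
proof -
  let ?s = "opol.induced n (free_s i)"
  note c = compatible_free_s[OF i]
  have on_letter: "free_s i (letter j) = - letter (swap_adj i j)" for j
    by (simp add: free_s_def)
  have hom: "?s \<in> ring_hom (OPol n) (OPol n)"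
  proof (rule ring_hom_memI)
    fix X Y assume "X \<in> carrier (OPol n)" "Y \<in> carrier (OPol n)"
    then obtain p q where "X = opol.cls n p" "Y = opol.cls n q" "p \<in> opol.F n" "q \<in> opol.F n"
      by (auto simp: opol_carrier)
    then show "?s X \<in> carrier (OPol n)"
      "?s (X \<otimes>\<^bsub>OPol n\<^esub> Y) = ?s X \<otimes>\<^bsub>OPol n\<^esub> ?s Y" "?s (X \<oplus>\<^bsub>OPol n\<^esub> Y) = ?s X \<oplus>\<^bsub>OPol n\<^esub> ?s Y"
      using opol.compatibleD[OF c]
      by (simp_all add: opol_simps opol.induced_cls[OF c] free_ring_closed opol_in_carrier)
        (simp_all add: free_s_def subst_map_mult subst_map_simps)
  qed (simp add: opol_simps opol.induced_cls[OF c] free_ring_closed, simp add: free_s_def subst_map_simps)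
  have gens: "?s (opol_x n j) = \<ominus>\<^bsub>OPol n\<^esub> opol_x n (swap_adj i j)" if "j \<in> {1..n}" for j
    using that swap_adj_range[OF i that]
    by (simp add: opol_x_cls opol.induced_cls[OF c] free_ring_closed opol_simps on_letter)
  show ?thesis
    unfolding opol_s_def
  proof (rule the_equality, intro conjI ballI)
    show "?s \<in> extensional (carrier (OPol n))"
      unfolding OPol_def by (rule opol.induced_extensional)
    show "?s (opol_x n i) = \<ominus>\<^bsub>OPol n\<^esub> opol_x n (i + 1)"
      "?s (opol_x n (i + 1)) = \<ominus>\<^bsub>OPol n\<^esub> opol_x n i"
      using gens[of i] gens[of "i + 1"] i by (simp_all add: swap_adj_def)
    fix j assume "j \<in> {1..n} - {i, i + 1}"
    then show "?s (opol_x n j) = \<ominus>\<^bsub>OPol n\<^esub> opol_x n j" using gens[of j] by (simp add: swap_adj_def)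
  next
    fix s
    assume s: "s \<in> extensional (carrier (OPol n)) \<and> s \<in> ring_hom (OPol n) (OPol n) \<and>
     s (opol_x n i) = \<ominus>\<^bsub>OPol n\<^esub> opol_x n (i + 1) \<and>
     s (opol_x n (i + 1)) = \<ominus>\<^bsub>OPol n\<^esub> opol_x n i \<and>
     (\<forall>j\<in>{1..n} - {i, i + 1}. s (opol_x n j) = \<ominus>\<^bsub>OPol n\<^esub> opol_x n j)"
    have gens': "s (opol_x n j) = ?s (opol_x n j)" if "j \<in> {1..n}" for j
      using s gens[OF that] that by (cases "j \<in> {i, i + 1}") (auto simp: swap_adj_def)
    show "s = ?s"
    proof (rule extensionalityI)
      show "s \<in> extensional (carrier (OPol n))" using s by blast
      show "?s \<in> extensional (carrier (OPol n))"
        unfolding OPol_def by (rule opol.induced_extensional)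
      fix X assume X: "X \<in> carrier (OPol n)"
      show "s X = ?s X"
      proof (rule opol_additive_eqI[OF ring.is_abelian_group[OF ring_OPol] _ _ _ _ X])
        show "s \<in> hom (add_monoid (OPol n)) (add_monoid (OPol n))"
          "?s \<in> hom (add_monoid (OPol n)) (add_monoid (OPol n))"
          using s hom ring_hom_additive by blast+
        show "s \<one>\<^bsub>OPol n\<^esub> = ?s \<one>\<^bsub>OPol n\<^esub>"
          using s hom ring_hom_one by metis
      next
        fix j Y assume "j \<in> {1..n}" "Y \<in> carrier (OPol n)" "s Y = ?s Y"
        moreover have "opol_x n j \<in> carrier (OPol n)"
          using \<open>j \<in> {1..n}\<close> by (simp add: opol_x_cls opol_in_carrier free_ring_closed)
        ultimately show "s (opol_x n j \<otimes>\<^bsub>OPol n\<^esub> Y) = ?s (opol_x n j \<otimes>\<^bsub>OPol n\<^esub> Y)"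
          using s gens'[of j] ring_hom_mult[of s "OPol n" "OPol n"] ring_hom_mult[OF hom] by simp
      qed
    qed
  qed (rule hom)
qed

lemma odd_dd_eq:
  assumes i: "i \<in> {1..<n}"
  shows "odd_dd n i = opol.induced n (free_dd i)"
proof -
  let ?D = "opol.induced n (free_dd i)" and ?s = "opol.induced n (free_s i)"
  note c = compatible_free_dd[OF i] and cs = compatible_free_s[OF i]
  have hom: "?D \<in> hom (add_monoid (OPol n)) (add_monoid (OPol n))"
    unfolding OPol_def by (rule opol.induced_hom[OF c])
  have one: "?D \<one>\<^bsub>OPol n\<^esub> = \<zero>\<^bsub>OPol n\<^esub>"
    by (simp add: opol_simps opol.induced_cls[OF c] free_ring_closed free_dd_simps)
  have gens: "?D (opol_x n j) = (if j \<in> {i, i + 1} then \<one>\<^bsub>OPol n\<^esub> else \<zero>\<^bsub>OPol n\<^esub>)"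
    if "j \<in> {1..n}" for j
    using that free_dd_letter_mult[of i j 1]
    by (simp add: opol_x_cls opol_simps opol.induced_cls[OF c] free_ring_closed free_dd_simps)
  have leibniz: "?D (X \<otimes>\<^bsub>OPol n\<^esub> Y) = ?D X \<otimes>\<^bsub>OPol n\<^esub> Y \<oplus>\<^bsub>OPol n\<^esub> opol_s n i X \<otimes>\<^bsub>OPol n\<^esub> ?D Y"
    if XY: "X \<in> carrier (OPol n)" "Y \<in> carrier (OPol n)" for X Y
  proof -
    obtain p q where "X = opol.cls n p" "Y = opol.cls n q" "p \<in> opol.F n" "q \<in> opol.F n"
      using XY by (auto simp: opol_carrier)
    then show ?thesis
      using opol.compatibleD[OF c] opol.compatibleD[OF cs]
      by (simp add: opol_s_eq[OF i] opol_simps opol.induced_cls[OF c] opol.induced_cls[OF cs]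
          free_ring_closed) (simp add: free_dd_def free_s_def skew_deriv_mult)
  qed
  show ?thesis
    unfolding odd_dd_def
  proof (rule the_equality, intro conjI ballI)
    show "?D \<in> extensional (carrier (OPol n))"
      unfolding OPol_def by (rule opol.induced_extensional)
  next
    fix D
    assume D: "D \<in> extensional (carrier (OPol n)) \<and>
     D \<in> hom (add_monoid (OPol n)) (add_monoid (OPol n)) \<and>
     D \<one>\<^bsub>OPol n\<^esub> = \<zero>\<^bsub>OPol n\<^esub> \<and>
     (\<forall>j\<in>{1..n}. D (opol_x n j) = (if j \<in> {i, i + 1} then \<one>\<^bsub>OPol n\<^esub> else \<zero>\<^bsub>OPol n\<^esub>)) \<and>
     (\<forall>f\<in>carrier (OPol n). \<forall>g\<in>carrier (OPol n).
        D (f \<otimes>\<^bsub>OPol n\<^esub> g) =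
          D f \<otimes>\<^bsub>OPol n\<^esub> g \<oplus>\<^bsub>OPol n\<^esub> opol_s n i f \<otimes>\<^bsub>OPol n\<^esub> D g)"
    show "D = ?D"
    proof (rule extensionalityI)
      show "D \<in> extensional (carrier (OPol n))" using D by blast
      show "?D \<in> extensional (carrier (OPol n))"
        unfolding OPol_def by (rule opol.induced_extensional)
      fix X assume X: "X \<in> carrier (OPol n)"
      show "D X = ?D X"
      proof (rule opol_additive_eqI[OF ring.is_abelian_group[OF ring_OPol] _ _ _ _ X])
        show "D \<in> hom (add_monoid (OPol n)) (add_monoid (OPol n))" using D by blast
        show "?D \<in> hom (add_monoid (OPol n)) (add_monoid (OPol n))" by (rule hom)
        show "D \<one>\<^bsub>OPol n\<^esub> = ?D \<one>\<^bsub>OPol n\<^esub>" using D one by simp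
      next
        fix j Y assume jY: "j \<in> {1..n}" "Y \<in> carrier (OPol n)" "D Y = ?D Y"
        moreover have x: "opol_x n j \<in> carrier (OPol n)"
          using \<open>j \<in> {1..n}\<close> by (simp add: opol_x_cls opol_in_carrier free_ring_closed)
        moreover have "D (opol_x n j) = ?D (opol_x n j)" using D gens[OF jY(1)] jY(1) by simp
        moreover have "D (opol_x n j \<otimes>\<^bsub>OPol n\<^esub> Y) =
            D (opol_x n j) \<otimes>\<^bsub>OPol n\<^esub> Y \<oplus>\<^bsub>OPol n\<^esub> opol_s n i (opol_x n j) \<otimes>\<^bsub>OPol n\<^esub> D Y"
          using D x jY(2) by blast
        ultimately show "D (opol_x n j \<otimes>\<^bsub>OPol n\<^esub> Y) = ?D (opol_x n j \<otimes>\<^bsub>OPol n\<^esub> Y)"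
          using leibniz by simp
      qed
    qed
  qed (fact hom one gens leibniz)+
qed

lemma compatible_free_T:
  assumes i: "i \<in> {1..<n}"
  shows "opol.compatible n (free_T i)"
proof -
  note c = opol.compatibleD[OF compatible_free_dd[OF i]]
  show ?thesis
    using c additive_free_T[of i] letter_diff_closed[OF i]
    by (simp add: opol.compatible_def free_T_def nil_part_def opol.I_closed free_ring_closed
)
qed

lemma hecke_operator_eq:
  assumes i: "i \<in> {1..<n}"
  shows "hecke_operator n i = opol.induced n (free_T i)"
proof (rule opol.induced_unique[OF _ compatible_free_T[OF i]])
  show "hecke_operator n i \<in> extensional (carrier (presented_ring {1..n} (opol_relators n)))"
    by (simp add: hecke_operator_def OPol_def)
  fix p assume p: "p \<in> opol.F n"
  note c = compatible_free_dd[OF i]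
  have "letter i \<in> opol.F n" using i by (simp add: free_ring_closed)
  then show "hecke_operator n i (opol.cls n p) = opol.cls n (free_T i p)"
    using p opol.compatibleD[OF c]
    by (simp add: hecke_operator_def opol_in_carrier odd_dd_eq[OF i] opol_x_cls opol_simps
        opol.induced_cls[OF c] free_ring_closed free_T_eq)
qed

section \<open>The Hecke action\<close>

lemma hecke_relators_closed: "hecke_relators n \<subseteq> carrier (free_ring {1..<n})"
proof -
  have "(2::word \<Rightarrow>\<^sub>0 int) = 1 + 1" by simp
  then have "(2::word \<Rightarrow>\<^sub>0 int) \<in> carrier (free_ring {1..<n})" by (simp only: free_ring_closed)
  then show ?thesis
    by (auto simp: hecke_relators_def free_ring_closed)
qed

interpretation hecke: presentation "{1..<n}" "hecke_relators n" for n
  by (simp add: presentation_def hecke_relators_closed)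

abbreviation act :: "(word \<Rightarrow>\<^sub>0 int) \<Rightarrow> (word \<Rightarrow>\<^sub>0 int) \<Rightarrow> word \<Rightarrow>\<^sub>0 int" where
  "act \<equiv> word_act free_T"

lemmas act_simps = word_act_diff word_act_plus word_act_one word_act_zero
  word_act_mult[OF additive_free_T] word_act_letter[OF additive_free_T]

lemma compatible_act:
  assumes "p \<in> hecke.F n"
  shows "opol.compatible n (act p)"
proof -
  have "act p g \<in> opol.F n" if "g \<in> opol.F n" for g
    by (rule word_act_preserves[OF additive_free_T assms that])
      (simp_all add: free_ring_closed opol.compatibleD[OF compatible_free_T])
  moreover have "act p g \<in> opol.I n" if "g \<in> opol.I n" for g
    by (rule word_act_preserves[OF additive_free_T assms that])
      (simp_all add: opol.I_closed opol.compatibleD[OF compatible_free_T])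
  ultimately show ?thesis
    by (simp add: opol.compatible_def additive_word_act[OF additive_free_T])
qed

text \<open>The quadratic relation holds already on the free ring. The other two hold only modulo the
  relations of skew polynomials: their defects are multiples of
  \<open>(x\<^sub>i - x\<^sub>i\<^sub>+\<^sub>1) (x\<^sub>j - x\<^sub>j\<^sub>+\<^sub>1) + (x\<^sub>j - x\<^sub>j\<^sub>+\<^sub>1) (x\<^sub>i - x\<^sub>i\<^sub>+\<^sub>1)\<close> and
  of the difference of the two cubics.\<close>

lemma act_relator:
  assumes "e \<in> hecke_relators n" "g \<in> opol.F n"
  shows "act e g \<in> opol.I n"
proof -
  have ddF: "free_dd i q \<in> opol.F n" if "i \<in> {1..<n}" "q \<in> opol.F n" for i q
    using opol.compatibleD(2)[OF compatible_free_dd] that by blast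
  consider (quadratic) i where "i \<in> {1..<n}" "e = letter i * letter i - (2 * letter i - 1)"
    | (far) i j where "i \<in> {1..<n}" "j \<in> {1..<n}" "i + 1 < j \<or> j + 1 < i"
        "e = letter i * letter j - letter j * letter i"
    | (braid) i where "i \<in> {1..<n}" "i + 1 \<in> {1..<n}"
        "e = letter i * letter (i + 1) * letter i - letter (i + 1) * letter i * letter (i + 1)"
    using assms(1) unfolding hecke_relators_def by fastforce
  then show ?thesis
  proof cases
    case quadratic
    then show ?thesis
      by (simp add: act_simps mult_2 free_T_quadratic opol.I_zero)
  next
    case far
    then show ?thesis
      using opol.I_rmult[OF opol.I_uminus[OF letter_diff_anticommute[OF far(1-3)]],
          of "free_dd i (free_dd j g)"]
      by (simp add: act_simps free_T_far nil_part_far ddF assms(2))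
  next
    case braid
    then show ?thesis
      using opol.I_rmult[OF letter_diff_braid[OF braid(1-2)],
          of "free_dd i (free_dd (i + 1) (free_dd i g))"]
      by (simp add: act_simps free_T_braid ddF assms(2))
  qed
qed

lemma act_ideal:
  assumes "p \<in> hecke.I n" "g \<in> opol.F n"
  shows "act p g \<in> opol.I n"
  using assms
proof (induction p arbitrary: g rule: hecke.I_induct)
  case (lmult q r)
  then show ?case
    using opol.compatibleD(3)[OF compatible_act] by (simp add: act_simps)
next
  case (rmult q r)
  then show ?case
    using opol.compatibleD(2)[OF compatible_act] by (simp add: act_simps)
qed (simp_all add: act_relator act_simps opol.I_closed)

lemma abelian_group_add_End:
  assumes "abelian_group R"
  shows "abelian_group (add_End R)"
proof -
  interpret abelian_group R by fact
  show ?thesis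
  proof (rule abelian_groupI)
    fix \<phi> assume \<phi>: "\<phi> \<in> carrier (add_End R)"
    show "\<exists>\<psi>\<in>carrier (add_End R). \<psi> \<oplus>\<^bsub>add_End R\<^esub> \<phi> = \<zero>\<^bsub>add_End R\<^esub>"
    proof (intro bexI[of _ "\<lambda>f\<in>carrier R. \<ominus>\<^bsub>R\<^esub> \<phi> f"])
      show "(\<lambda>f\<in>carrier R. \<ominus>\<^bsub>R\<^esub> \<phi> f) \<in> carrier (add_End R)"
        using \<phi> by (auto simp: add_End_def hom_def Pi_iff minus_add)
      show "(\<lambda>f\<in>carrier R. \<ominus>\<^bsub>R\<^esub> \<phi> f) \<oplus>\<^bsub>add_End R\<^esub> \<phi> = \<zero>\<^bsub>add_End R\<^esub>"
        using \<phi> by (auto simp: add_End_def hom_def Pi_iff l_neg fun_eq_iff restrict_def)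
    qed
  next
    fix \<phi> assume \<phi>: "\<phi> \<in> carrier (add_End R)"
    show "\<zero>\<^bsub>add_End R\<^esub> \<oplus>\<^bsub>add_End R\<^esub> \<phi> = \<phi>"
      using \<phi> by (auto simp: add_End_def hom_def Pi_iff fun_eq_iff restrict_def extensional_def)
  qed (auto simp: add_End_def hom_def Pi_iff a_ac fun_eq_iff restrict_def extensional_def)
qed

text \<open>The candidate for the action; that it respects the Hecke relations is the content of the lemma
  \<open>act_ideal\<close>.\<close>

definition hecke_rep :: "nat \<Rightarrow> (word \<Rightarrow>\<^sub>0 int) set \<Rightarrow> (word \<Rightarrow>\<^sub>0 int) set \<Rightarrow> (word \<Rightarrow>\<^sub>0 int) set" where
  "hecke_rep n = hecke.descend n (\<lambda>p. opol.induced n (act p))"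

lemma hecke_rep_cls:
  assumes p: "p \<in> hecke.F n"
  shows "hecke_rep n (hecke.cls n p) = opol.induced n (act p)"
  unfolding hecke_rep_def
proof (rule hecke.descend_cls[OF p])
  fix p q assume pq: "p \<in> hecke.F n" "q \<in> hecke.F n" "p - q \<in> hecke.I n"
  show "opol.induced n (act p) = opol.induced n (act q)"
  proof (rule opol.induced_unique[OF opol.induced_extensional compatible_act[OF pq(2)]])
    fix g assume g: "g \<in> opol.F n"
    have "act p g - act q g \<in> opol.I n"
      using act_ideal[OF pq(3) g] by (simp add: act_simps)
    then show "opol.induced n (act p) (opol.cls n g) = opol.cls n (act q g)"
      using g pq opol.compatibleD(2)[OF compatible_act]
      by (simp add: opol.induced_cls compatible_act opol.cls_eq_iff)
  qed
qed

lemma induced_act_mult: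
  assumes "p \<in> hecke.F n" "q \<in> hecke.F n"
  shows "opol.induced n (act (p * q)) =
    compose (carrier (OPol n)) (opol.induced n (act p)) (opol.induced n (act q))"
  by (rule opol.induced_unique[symmetric])
    (simp_all add: compose_def OPol_def compatible_act assms free_ring_closed opol.induced_cls
      opol.compatibleD(2)[OF compatible_act] act_simps)

lemma induced_act_plus:
  assumes "p \<in> hecke.F n" "q \<in> hecke.F n"
  shows "opol.induced n (act (p + q)) =
    (\<lambda>f\<in>carrier (OPol n). opol.induced n (act p) f \<oplus>\<^bsub>OPol n\<^esub> opol.induced n (act q) f)"
  by (rule opol.induced_unique[symmetric])
    (simp_all add: OPol_def compatible_act assms free_ring_closed opol.induced_cls
      opol.compatibleD(2)[OF compatible_act] act_simps opol.Q_simps)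

lemma induced_act_one: "opol.induced n (act 1) = (\<lambda>f\<in>carrier (OPol n). f)"
  by (rule opol.induced_unique[symmetric])
    (simp_all add: OPol_def compatible_act free_ring_closed act_simps)

lemma hecke_rep_hom: "hecke_rep n \<in> ring_hom (Hecke n) (add_End (OPol n))"
proof (rule ring_hom_memI)
  fix X Y assume "X \<in> carrier (Hecke n)" "Y \<in> carrier (Hecke n)"
  then obtain p q where "X = hecke.cls n p" "Y = hecke.cls n q" "p \<in> hecke.F n" "q \<in> hecke.F n"
    by (auto simp: Hecke_def hecke.carrier_Q)
  then show "hecke_rep n X \<in> carrier (add_End (OPol n))"
    "hecke_rep n (X \<otimes>\<^bsub>Hecke n\<^esub> Y) = hecke_rep n X \<otimes>\<^bsub>add_End (OPol n)\<^esub> hecke_rep n Y"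
    "hecke_rep n (X \<oplus>\<^bsub>Hecke n\<^esub> Y) = hecke_rep n X \<oplus>\<^bsub>add_End (OPol n)\<^esub> hecke_rep n Y"
    using opol.induced_hom[OF compatible_act, of p n]
    by (simp_all add: Hecke_def hecke.Q_simps hecke_rep_cls free_ring_closed add_End_def
        induced_act_mult induced_act_plus)
      (simp add: OPol_def opol.induced_extensional)
qed (simp add: Hecke_def hecke.Q_simps hecke_rep_cls free_ring_closed add_End_def induced_act_one)

lemma hecke_rep_T:
  assumes "i \<in> {1..<n}"
  shows "hecke_rep n (hecke_T n i) = hecke_operator n i"
proof -
  have "act (letter i) = free_T i" by (simp add: fun_eq_iff act_simps)
  then show ?thesis
    using assms by (simp add: hecke_T_def generator_def hecke_rep_cls free_ring_closed
        hecke_operator_eq)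
qed

lemma hecke_action_eq: "hecke_action n = hecke_rep n"
  unfolding hecke_action_def
proof (rule the_equality, intro conjI ballI)
  show ext: "hecke_rep n \<in> extensional (carrier (Hecke n))"
    by (simp add: hecke_rep_def Hecke_def hecke.descend_extensional)
  fix \<rho>
  assume \<rho>: "\<rho> \<in> extensional (carrier (Hecke n)) \<and>
     \<rho> \<in> ring_hom (Hecke n) (add_End (OPol n)) \<and>
     (\<forall>i\<in>{1..<n}. \<rho> (hecke_T n i) = hecke_operator n i)"
  show "\<rho> = hecke_rep n"
  proof (rule extensionalityI[OF _ ext])
    show "\<rho> \<in> extensional (carrier (Hecke n))" using \<rho> by blast
    fix X assume X: "X \<in> carrier (Hecke n)"
    show "\<rho> X = hecke_rep n X"
    proof (rule hecke.additive_eqI[of "add_End (OPol n)" _ n, folded Hecke_def hecke_T_def,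
          OF _ _ _ _ _ X])
      show "abelian_group (add_End (OPol n))"
        by (rule abelian_group_add_End[OF ring.is_abelian_group[OF ring_OPol]])
      show "\<rho> \<in> hom (add_monoid (Hecke n)) (add_monoid (add_End (OPol n)))"
        "hecke_rep n \<in> hom (add_monoid (Hecke n)) (add_monoid (add_End (OPol n)))"
        using \<rho> hecke_rep_hom ring_hom_additive by blast+
      show "\<rho> \<one>\<^bsub>Hecke n\<^esub> = hecke_rep n \<one>\<^bsub>Hecke n\<^esub>"
        using \<rho> hecke_rep_hom ring_hom_one by metis
    next
      fix j Y assume j: "j \<in> {1..<n}" "Y \<in> carrier (Hecke n)" "\<rho> Y = hecke_rep n Y"
      then have "hecke_T n j \<in> carrier (Hecke n)"
        by (simp add: hecke_T_def generator_def Hecke_def free_ring_closed)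
      then show "\<rho> (hecke_T n j \<otimes>\<^bsub>Hecke n\<^esub> Y) = hecke_rep n (hecke_T n j \<otimes>\<^bsub>Hecke n\<^esub> Y)"
        using j \<rho> hecke_rep_T[of j n] ring_hom_mult[of \<rho> "Hecke n" "add_End (OPol n)"]
          ring_hom_mult[OF hecke_rep_hom[of n]] by simp
    qed
  qed
qed (simp_all add: hecke_rep_hom hecke_rep_T)

text \<open>Since \<open>T\<^sub>i f - f = (x\<^sub>i - x\<^sub>i\<^sub>+\<^sub>1) \<partial>\<^sub>i f\<close>, this is the cancellation lemma.\<close>

lemma hecke_T_fixes_iff:
  assumes i: "i \<in> {1..<n}" and f: "f \<in> carrier (OPol n)"
  shows "hecke_action n (hecke_T n i) f = f \<longleftrightarrow> f \<in> a_kernel (OPol n) (OPol n) (odd_dd n i)"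
proof -
  obtain p where p: "p \<in> opol.F n" "f = opol.cls n p" using f by (auto simp: opol_carrier)
  note T = compatible_free_T[OF i] and D = compatible_free_dd[OF i]
  have F: "free_dd i p \<in> opol.F n" "free_T i p \<in> opol.F n"
    using opol.compatibleD(2)[OF D] opol.compatibleD(2)[OF T] p by blast+
  have "hecke_action n (hecke_T n i) f = f \<longleftrightarrow> free_T i p - p \<in> opol.I n"
    using p F by (simp add: hecke_action_eq hecke_rep_T[OF i] hecke_operator_eq[OF i]
        opol.induced_cls[OF T] opol.cls_eq_iff)
  also have "\<dots> \<longleftrightarrow> letter_diff i * free_dd i p \<in> opol.I n"
    by (simp add: free_T_def nil_part_def)
  also have "\<dots> \<longleftrightarrow> free_dd i p \<in> opol.I n"
    using letter_diff_cancel[OF i F(1)] opol.I_lmult letter_diff_closed[OF i] by blast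
  also have "\<dots> \<longleftrightarrow> f \<in> a_kernel (OPol n) (OPol n) (odd_dd n i)"
    using p F f opol.cls_zero_iff[folded OPol_def]
    by (simp add: a_kernel_def' odd_dd_eq[OF i] opol.induced_cls[OF D])
  finally show ?thesis .
qed

theorem proposition2p3:
  fixes n :: nat and f :: "(word \<Rightarrow>\<^sub>0 int) set"
  assumes "n \<ge> 1" and "f \<in> carrier (OPol n)"
  shows "(\<forall>i\<in>{1..n - 1}. hecke_action n (hecke_T n i) f = f) \<longleftrightarrow> f \<in> OLambda n"
proof -
  have "{1..n - 1} = {1..<n}" using assms(1) by auto
  then show ?thesis
    using hecke_T_fixes_iff[OF _ assms(2)] assms(2) by (auto simp: OLambda_def)
qed

end
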